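(* There is a constant $c>0$ such that for every positive integer $n$ there exists an $n$-component monotone network $f:\{0,1\}^n\to\{0,1\}^n$ whose fixing length satisfies $\lambda(f)\ge c\,n^2$.
   Context: An $n$-component (Boolean) network is a function $f=(f_1,\dots,f_n):\{0,1\}^n\to\{0,1\}^n$. Write $[n]=\{1,\dots,n\}$. For $i\in[n]$ and $x\in\{0,1\}^n$, $f^i(x):=(x_1,\dots,x_{i-1},f_i(x),x_{i+1},\dots,x_n)$. For a word $w=i_1i_2\dots i_k$ over the alphabet $[n]$, $f^w:=f^{i_k}\circ\cdots\circ f^{i_1}$ (and $f^\epsilon=\mathrm{id}$ for the empty word $\epsilon$). A word $w$ fixes $f$ if $f^w(x)$ is a fixed point of $f$ for every $x\in\{0,1\}^n$; $f$ is fixable if some word fixes it, and then the fixing length $\lambda(f)$ is the minimum length of a word fixing $f$. The order on $\{0,1\}^n$ is componentwise: $x\le y$ iff $x_i\le y_i$ for all $i\in[n]$. The network $f$ is monotone if $x\le y$ implies $f(x)\le f(y)$ for all $x,y$. (Monotone networks are known to be fixable, so $\lambda(f)$ is defined.) *)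

theory Defs
  imports Complex_Main "HOL-Library.FuncSet"
begin

(* Configurations are functions on the index set {1..n} with False, True for 0, 1.  They are
   extensional, so equality and the function order of the library depend on the components
   1, ..., n only (see cube_le_iff). *)
definition cube :: "nat \<Rightarrow> (nat \<Rightarrow> bool) set" where
  "cube n = ({1..n} \<rightarrow>\<^sub>E UNIV)"

definition network :: "nat \<Rightarrow> ((nat \<Rightarrow> bool) \<Rightarrow> (nat \<Rightarrow> bool)) \<Rightarrow> bool" where
  "network n f \<longleftrightarrow> f \<in> cube n \<rightarrow> cube n"

definition monotone_network :: "nat \<Rightarrow> ((nat \<Rightarrow> bool) \<Rightarrow> (nat \<Rightarrow> bool)) \<Rightarrow> bool" where
  "monotone_network n f \<longleftrightarrow> network n f \<and> mono_on (cube n) f"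

definition update :: "((nat \<Rightarrow> bool) \<Rightarrow> (nat \<Rightarrow> bool)) \<Rightarrow> nat \<Rightarrow> (nat \<Rightarrow> bool) \<Rightarrow> (nat \<Rightarrow> bool)" where
  "update f i x = x(i := f x i)"

(* The first letter of the word acts first. *)
definition update_word ::
    "((nat \<Rightarrow> bool) \<Rightarrow> (nat \<Rightarrow> bool)) \<Rightarrow> nat list \<Rightarrow> (nat \<Rightarrow> bool) \<Rightarrow> (nat \<Rightarrow> bool)" where
  "update_word f w = fold (update f) w"

definition fixing_word :: "nat \<Rightarrow> ((nat \<Rightarrow> bool) \<Rightarrow> (nat \<Rightarrow> bool)) \<Rightarrow> nat list \<Rightarrow> bool" where
  "fixing_word n f w \<longleftrightarrow>
     w \<in> lists {1..n} \<and> (\<forall>x\<in>cube n. f (update_word f w x) = update_word f w x)"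

definition fixable :: "nat \<Rightarrow> ((nat \<Rightarrow> bool) \<Rightarrow> (nat \<Rightarrow> bool)) \<Rightarrow> bool" where
  "fixable n f \<longleftrightarrow> (\<exists>w. fixing_word n f w)"

(* Meaningful for fixable networks only; otherwise the value is unspecified. *)
definition fixing_length :: "nat \<Rightarrow> ((nat \<Rightarrow> bool) \<Rightarrow> (nat \<Rightarrow> bool)) \<Rightarrow> nat" where
  "fixing_length n f = (LEAST k. \<exists>w. fixing_word n f w \<and> length w = k)"

lemma cube_le_iff:
  assumes "x \<in> cube n" and "y \<in> cube n"
  shows "x \<le> y \<longleftrightarrow> (\<forall>i\<in>{1..n}. x i \<le> y i)"
proof
  assume le: "\<forall>i\<in>{1..n}. x i \<le> y i"
  show "x \<le> y"
  proof (rule le_funI)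
    fix i
    show "x i \<le> y i"
    proof (cases "i \<in> {1..n}")
      case True
      then show ?thesis using le by blast
    next
      case False
      then have "x i = undefined" and "y i = undefined"
        using assms PiE_arb unfolding cube_def by metis+
      then show ?thesis by simp
    qed
  qed
qed (simp add: le_fun_def)

lemma update_in_cube:
  assumes "x \<in> cube n" and "i \<in> {1..n}"
  shows "update f i x \<in> cube n"
  using assms by (auto simp: cube_def update_def PiE_def extensional_def)

end

theory Submission
  imports Defs "HOL-Library.Sublist" "HOL-Combinatorics.Multiset_Permutations"
begin

text \<open>
  Half of the components of the network are data, the other half are controls, which never change.
  When exactly four controls are on, they select a permutation of the data components, and the data
  form a path along it: a component is switched on iff all its predecessors are on. With more than
  four controls on, the data are driven to one, with fewer to zero; since the sets of size four form
  an antichain, the network is monotone. Started with all data off, a fixing word has to contain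
  every selected permutation as a subsequence. A word of length \<open>L\<close> contains at most
  \<open>L choose m\<close> permutations of \<open>m\<close> letters, which is at most half of all if
  \<open>L \<le> m\<^sup>2 / 18\<close>, so counting shows that more than \<open>m * L\<close> permutations can be
  chosen which no word of length \<open>L\<close> contains simultaneously.
\<close>

section \<open>Permutations without short common supersequences\<close>

text \<open>A single term of the exponential series at \<open>m\<close>, namely
  \<open>m^m / fact m\<close>, is at most the whole sum \<open>exp m\<close>, and
  \<open>exp 1 \<le> 3\<close>.\<close>

lemma fact_ge_power_div_3: "(real m / 3) ^ m \<le> fact m"
proof -
  have "(\<Sum>k\<in>{m}. real m ^ k /\<^sub>R fact k) \<le> (\<Sum>k. real m ^ k /\<^sub>R fact k)"
    using exp_converges[of "real m"] by (intro sum_le_suminf) (auto simp: sums_iff)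
  then have "real m ^ m / fact m \<le> exp (real m)"
    using exp_converges[of "real m"] by (simp add: sums_iff divide_inverse mult.commute)
  also have "\<dots> = exp 1 ^ m"
    by (simp flip: exp_of_nat_mult)
  also have "\<dots> \<le> 3 ^ m"
    by (intro power_mono exp_le) auto
  finally show ?thesis
    by (simp add: power_divide field_simps)
qed

lemma card_subseqs_of_length_le: "card {xs. subseq xs w \<and> length xs = k} \<le> length w choose k"
proof -
  have "{xs. subseq xs w \<and> length xs = k} \<subseteq> nths w ` {I. I \<subseteq> {..<length w} \<and> card I = k}"
  proof clarify
    fix xs assume "subseq xs w" and k: "k = length xs"
    then obtain I where I: "xs = nths w I"
      by (auto simp: subseq_conv_nths)
    \<comment> \<open>Positions beyond the end of \<open>w\<close> select nothing; cutting them off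
      makes the number of positions equal to the length of the subsequence.\<close>
    have "nths w I = nths w (I \<inter> {..<length w})"
      unfolding nths_def by (rule arg_cong[where f = "map fst"], rule filter_cong)
        (auto dest: set_zip_rightD)
    moreover have "card (I \<inter> {..<length w}) = length xs"
      by (auto simp: I length_nths intro!: arg_cong[where f = card])
    ultimately show "xs \<in> nths w ` {I. I \<subseteq> {..<length w} \<and> card I = length xs}"
      using I by auto
  qed
  then have "card {xs. subseq xs w \<and> length xs = k} \<le>
      card (nths w ` {I. I \<subseteq> {..<length w} \<and> card I = k})"
    by (intro card_mono) auto
  also have "\<dots> \<le> card {I. I \<subseteq> {..<length w} \<and> card I = k}"
    by (intro card_image_le) auto
  also have "\<dots> = length w choose k"
    by (simp add: n_subsets)
  finally show ?thesis .
qed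

text \<open>The constant is 18 = 2 * 3 * 3: with \<open>(L choose m) * fact m \<le> L ^ m\<close>,
  the two factors 3 turn \<open>(m\<^sup>2 / 9) ^ m\<close> into at most
  \<open>fact m * fact m\<close>, and the factor 2 leaves a gain of \<open>2 ^ m\<close>, of which
  one factor 2 is kept.\<close>

lemma twice_choose_le_fact:
  assumes "m \<ge> 1" and "18 * L \<le> m\<^sup>2"
  shows "2 * (L choose m) \<le> fact m"
proof -
  have "real (L choose m) * fact m \<le> real L ^ m"
    using binomial_fact_pow[of L m] by (metis of_nat_fact of_nat_le_iff of_nat_mult of_nat_power)
  moreover have "real L \<le> (real m)\<^sup>2 / 18"
    using assms(2) by (simp flip: of_nat_power)
  ultimately have "2 ^ m * (real (L choose m) * fact m) \<le> 2 ^ m * ((real m)\<^sup>2 / 18) ^ m"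
    by (meson mult_left_mono order_trans of_nat_0_le_iff power_mono zero_le_power zero_le_numeral)
  also have "\<dots> = (real m / 3) ^ m * (real m / 3) ^ m"
    by (simp add: power2_eq_square flip: power_mult_distrib)
  also have "\<dots> \<le> fact m * fact m"
    by (intro mult_mono fact_ge_power_div_3) auto
  finally have "2 ^ m * real (L choose m) \<le> fact m"
    by (simp add: field_simps)
  moreover have "2 * real (L choose m) \<le> 2 ^ m * real (L choose m)"
    using power_increasing[OF assms(1), of "2 :: real"] by (intro mult_right_mono) simp_all
  ultimately have "2 * real (L choose m) \<le> fact m"
    by linarith
  then show ?thesis
    by (metis of_nat_fact of_nat_le_iff of_nat_mult of_nat_numeral)
qed

text \<open>A union bound over words. With \<open>m = card A\<close>, one fixed word of length
  \<open>L\<close> contains all members of at most \<open>(L choose m) ^ card I\<close> families,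
  hence of at most a fraction \<open>1 / 2 ^ card I\<close> of all families. There are only
  \<open>m ^ L\<close> such words, and \<open>m ^ L < 2 ^ card I\<close>, so some family is
  contained in none of them.\<close>

lemma permutations_without_short_supersequence:
  fixes A :: "'a set" and I :: "'b set"
  assumes A: "finite A" "card A \<ge> 1" and I: "finite I" "card I > card A * L"
    and L: "18 * L \<le> (card A)\<^sup>2"
  obtains g where "\<And>i. i \<in> I \<Longrightarrow> g i \<in> permutations_of_set A"
    and "\<And>w. w \<in> lists A \<Longrightarrow> (\<And>i. i \<in> I \<Longrightarrow> subseq (g i) w) \<Longrightarrow> length w > L"
proof -
  let ?m = "card A" and ?P = "permutations_of_set A"
  let ?B = "L choose ?m"
  define Q where "Q w = {xs \<in> ?P. subseq xs w}" for w
  define W where "W = {w. set w \<subseteq> A \<and> length w = L}"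
  have "finite W" and card_W: "card W = ?m ^ L"
    unfolding W_def using A by (auto simp: finite_lists_length_eq card_lists_length_eq)
  have finite_Q: "finite (Q w)" for w
    unfolding Q_def by simp
  have card_Q: "card (Q w) \<le> ?B" if "w \<in> W" for w
  proof -
    have "Q w \<subseteq> {xs. subseq xs w \<and> length xs = ?m}"
      by (auto simp: Q_def length_finite_permutations_of_set)
    moreover have "finite {xs. subseq xs w \<and> length xs = ?m}"
      by (rule finite_subset[of _ "set (subseqs w)"]) auto
    ultimately have "card (Q w) \<le> card {xs. subseq xs w \<and> length xs = ?m}"
      by (rule card_mono[rotated])
    then show ?thesis
      using card_subseqs_of_length_le[of w ?m] that by (simp add: W_def)
  qed
  have "\<not> (I \<rightarrow>\<^sub>E ?P) \<subseteq> (\<Union>w\<in>W. I \<rightarrow>\<^sub>E Q w)"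
  proof
    assume "(I \<rightarrow>\<^sub>E ?P) \<subseteq> (\<Union>w\<in>W. I \<rightarrow>\<^sub>E Q w)"
    then have "card (I \<rightarrow>\<^sub>E ?P) \<le> card (\<Union>w\<in>W. I \<rightarrow>\<^sub>E Q w)"
      using \<open>finite W\<close> I finite_Q by (intro card_mono) (auto intro!: finite_PiE)
    also have "\<dots> \<le> (\<Sum>w\<in>W. card (I \<rightarrow>\<^sub>E Q w))"
      using \<open>finite W\<close> by (rule card_UN_le)
    also have "\<dots> \<le> (\<Sum>w\<in>W. ?B ^ card I)"
      using I card_Q by (intro sum_mono) (simp add: card_PiE power_mono)
    finally have "fact ?m ^ card I \<le> ?m ^ L * ?B ^ card I"
      using A I by (simp add: card_PiE card_W)
    \<comment> \<open>Doubling \<open>?B\<close> once per index makes it comparable with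
      \<open>fact ?m\<close>; the powers of the factorial then cancel.\<close>
    then have "2 ^ card I * fact ?m ^ card I \<le> ?m ^ L * (2 * ?B) ^ card I"
      by (simp add: power_mult_distrib)
    also have "\<dots> \<le> ?m ^ L * fact ?m ^ card I"
      using twice_choose_le_fact[OF A(2) L] by (intro mult_left_mono power_mono) auto
    finally have "2 ^ card I \<le> ?m ^ L"
      by simp
    also have "\<dots> \<le> (2 ^ ?m) ^ L"
      by (intro power_mono less_imp_le[OF less_exp]) auto
    also have "\<dots> < 2 ^ card I"
      using I(2) by (simp flip: power_mult)
    finally show False
      by simp
  qed
  then obtain g where g: "g \<in> I \<rightarrow>\<^sub>E ?P" "\<And>w. w \<in> W \<Longrightarrow> g \<notin> (I \<rightarrow>\<^sub>E Q w)"
    by blast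
  show ?thesis
  proof
    show "g i \<in> ?P" if "i \<in> I" for i
      using g(1) that by auto
    fix w assume w: "w \<in> lists A" "\<And>i. i \<in> I \<Longrightarrow> subseq (g i) w"
    show "length w > L"
    proof (rule ccontr)
      assume short: "\<not> length w > L"
      obtain a where "a \<in> A"
        using A by fastforce
      \<comment> \<open>The counting concerns words of length exactly \<open>L\<close>. Shorter
        words are padded, which keeps all their subsequences.\<close>
      define v where "v = w @ replicate (L - length w) a"
      have "v \<in> W"
        using w(1) \<open>a \<in> A\<close> short by (auto simp: v_def W_def)
      moreover have "g \<in> (I \<rightarrow>\<^sub>E Q v)"
        using g(1) w(2) by (fastforce simp: Q_def v_def PiE_iff)
      ultimately show False
        using g(2) by blast
    qed
  qed
qed

section \<open>Monotone networks are fixable\<close>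

lemma update_word_Nil [simp]: "update_word f [] x = x"
  and update_word_Cons [simp]: "update_word f (i # w) x = update_word f w (update f i x)"
  and update_word_append [simp]:
    "update_word f (v @ w) x = update_word f w (update_word f v x)"
  by (simp_all add: update_word_def)

lemma update_word_in_cube:
  assumes "x \<in> cube n" and "w \<in> lists {1..n}"
  shows "update_word f w x \<in> cube n"
  using assms by (induction w arbitrary: x) (simp_all add: update_in_cube del: One_nat_def)

lemma update_fixed_point: "f x = x \<Longrightarrow> update f i x = x"
  by (simp add: update_def)

lemma update_word_fixed_point: "f x = x \<Longrightarrow> update_word f w x = x"
  by (induction w) (simp_all add: update_fixed_point)

lemma cube_eqI:
  assumes "x \<in> cube n" "y \<in> cube n" "\<And>i. i \<in> {1..n} \<Longrightarrow> x i = y i"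
  shows "x = y"
  using assms unfolding cube_def by (rule PiE_ext)

lemma network_in_cube: "network n f \<Longrightarrow> x \<in> cube n \<Longrightarrow> f x \<in> cube n"
  by (auto simp: network_def)

text \<open>As long as some component is off and \<open>f\<close> wants it on, updating it lowers
  the number of components that are off. When no such component remains, \<open>f\<close> can only
  switch components off.\<close>

lemma reach_post_fixed_point:
  assumes "x \<in> cube n"
  shows "\<exists>w\<in>lists {1..n}. \<forall>i\<in>{1..n}. f (update_word f w x) i \<le> update_word f w x i"
  using assms
proof (induction "card {i \<in> {1..n}. \<not> x i}" arbitrary: x rule: less_induct)
  case less
  show ?case
  proof (cases "\<forall>i\<in>{1..n}. f x i \<le> x i")
    case True
    then show ?thesis
      by (intro bexI[of _ "[]"]) auto
  next
    case False
    then obtain i where i: "i \<in> {1..n}" "f x i" "\<not> x i"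
      by auto
    have "{j \<in> {1..n}. \<not> update f i x j} \<subset> {j \<in> {1..n}. \<not> x j}"
      using i by (auto simp: update_def)
    then have "card {j \<in> {1..n}. \<not> update f i x j} < card {j \<in> {1..n}. \<not> x j}"
      by (intro psubset_card_mono) auto
    from less.hyps[OF this update_in_cube[OF less.prems i(1)]]
    obtain w where "w \<in> lists {1..n}"
      "\<forall>j\<in>{1..n}. f (update_word f w (update f i x)) j \<le> update_word f w (update f i x) j"
      by blast
    then show ?thesis
      using i(1) by (intro bexI[of _ "i # w"]) auto
  qed
qed

text \<open>Updating a component with \<open>f x i < x i\<close> gives \<open>y \<le> x\<close>, so
  \<open>f y \<le> f x\<close> by monotonicity. As \<open>f x\<close> is below \<open>x\<close>, and
  \<open>y\<close> differs from \<open>x\<close> only at \<open>i\<close>, where it equals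
  \<open>f x i\<close>, the inequality passes on to \<open>y\<close>, with fewer components
  on.\<close>

lemma reach_fixed_point_from_post_fixed_point:
  assumes "monotone_network n f" "x \<in> cube n" "\<forall>i\<in>{1..n}. f x i \<le> x i"
  shows "\<exists>w\<in>lists {1..n}. f (update_word f w x) = update_word f w x"
  using assms(2,3)
proof (induction "card {i \<in> {1..n}. x i}" arbitrary: x rule: less_induct)
  case less
  have net: "network n f" and mono: "mono_on (cube n) f"
    using assms(1) by (auto simp: monotone_network_def)
  show ?case
  proof (cases "\<forall>i\<in>{1..n}. f x i = x i")
    case True
    then have "f x = x"
      using less.prems net by (intro cube_eqI[of _ n]) (auto intro: network_in_cube)
    then show ?thesis
      by (intro bexI[of _ "[]"]) auto
  next
    case False
    then obtain i where "i \<in> {1..n}" "f x i \<noteq> x i"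
      by blast
    with less.prems(2) have i: "i \<in> {1..n}" "\<not> f x i" "x i"
      by auto
    let ?y = "update f i x"
    have y: "?y \<in> cube n"
      using less.prems i by (intro update_in_cube)
    have "?y \<le> x"
      using i by (auto simp: update_def le_fun_def)
    then have "f ?y \<le> f x"
      using mono y less.prems by (simp add: mono_onD)
    then have post: "\<forall>j\<in>{1..n}. f ?y j \<le> ?y j"
      using less.prems(2) by (auto simp: update_def le_fun_def)
    have "{j \<in> {1..n}. ?y j} \<subset> {j \<in> {1..n}. x j}"
      using i by (auto simp: update_def)
    then have "card {j \<in> {1..n}. ?y j} < card {j \<in> {1..n}. x j}"
      by (intro psubset_card_mono) auto
    from less.hyps[OF this y post] obtain w where "w \<in> lists {1..n}"
      "f (update_word f w ?y) = update_word f w ?y"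
      by blast
    then show ?thesis
      using i(1) by (intro bexI[of _ "i # w"]) auto
  qed
qed

text \<open>One word must serve all initial configurations. They are treated one after another: the
  word built so far is extended by one that fixes the image of the next configuration, and
  configurations already brought to a fixed point are not disturbed by further updates.\<close>

lemma monotone_network_fixable:
  assumes "monotone_network n f"
  shows "fixable n f"
proof -
  have reach: "\<exists>w\<in>lists {1..n}. f (update_word f w x) = update_word f w x"
    if x: "x \<in> cube n" for x
  proof -
    obtain v where v: "v \<in> lists {1..n}"
      "\<forall>i\<in>{1..n}. f (update_word f v x) i \<le> update_word f v x i"
      using reach_post_fixed_point[OF x] by blast
    obtain w where "w \<in> lists {1..n}"
      "f (update_word f w (update_word f v x)) = update_word f w (update_word f v x)"
      using reach_fixed_point_from_post_fixed_point[OF assms update_word_in_cube[OF x v(1)] v(2)]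
      by blast
    then show ?thesis
      using v(1) by (intro bexI[of _ "v @ w"]) auto
  qed
  have "\<exists>w\<in>lists {1..n}. \<forall>x\<in>X. f (update_word f w x) = update_word f w x"
    if "finite X" "X \<subseteq> cube n" for X
    using that
  proof (induction X)
    case empty
    show ?case
      by (intro bexI[of _ "[]"]) auto
  next
    case (insert x X)
    then obtain v where v: "v \<in> lists {1..n}"
      "\<forall>y\<in>X. f (update_word f v y) = update_word f v y"
      by auto
    have "x \<in> cube n"
      using insert.prems by simp
    then obtain w where w: "w \<in> lists {1..n}"
      "f (update_word f w (update_word f v x)) = update_word f w (update_word f v x)"
      using reach[OF update_word_in_cube[OF _ v(1)]] by blast
    have "f (update_word f (v @ w) y) = update_word f (v @ w) y" if "y \<in> insert x X" for y
    proof (cases "y = x")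
      case True
      then show ?thesis
        using w(2) by simp
    next
      case False
      then have fixed: "f (update_word f v y) = update_word f v y"
        using that v(2) by blast
      have "update_word f (v @ w) y = update_word f v y"
        using update_word_fixed_point[of f "update_word f v y" w] fixed by simp
      with fixed show ?thesis
        by simp
    qed
    then show ?case
      using v(1) w(1) by (intro bexI[of _ "v @ w"]) auto
  qed
  from this[of "cube n"] have "\<exists>w\<in>lists {1..n}.
      \<forall>x\<in>cube n. f (update_word f w x) = update_word f w x"
    by (simp add: cube_def finite_PiE)
  then show ?thesis
    unfolding fixable_def fixing_word_def by blast
qed

text \<open>Fixability makes the \<open>LEAST\<close> in \<open>fixing_length\<close> attained, so
  that a bound on every fixing word applies to it.\<close>

lemma fixing_length_geI:
  assumes "fixable n f" "\<And>w. fixing_word n f w \<Longrightarrow> k \<le> length w"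
  shows "k \<le> fixing_length n f"
proof -
  have "\<exists>k w. fixing_word n f w \<and> length w = k"
    using assms(1) by (auto simp: fixable_def)
  then have "\<exists>w. fixing_word n f w \<and> length w = fixing_length n f"
    unfolding fixing_length_def by (rule LeastI_ex)
  then obtain w where w: "fixing_word n f w" "length w = fixing_length n f"
    by blast
  show ?thesis
    using assms(2)[OF w(1)] w(2) by simp
qed

section \<open>Path networks selected by controls\<close>

definition controls :: "nat \<Rightarrow> nat \<Rightarrow> (nat \<Rightarrow> bool) \<Rightarrow> nat set" where
  "controls m n x = {i \<in> {m<..n}. x i}"

text \<open>The \<open>takeWhile\<close> cuts the selected permutation just before \<open>i\<close>,
  leaving the predecessors of \<open>i\<close>. The first entry has none and is switched on
  unconditionally when exactly \<open>k\<close> controls are on.\<close>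

definition path_network ::
    "nat \<Rightarrow> nat \<Rightarrow> nat \<Rightarrow> (nat set \<Rightarrow> nat list) \<Rightarrow> (nat \<Rightarrow> bool) \<Rightarrow> nat \<Rightarrow> bool" where
  "path_network m n k g x = (\<lambda>i\<in>{1..n}.
     if m < i then x i
     else card (controls m n x) > k \<or>
       card (controls m n x) = k \<and> (\<forall>j\<in>set (takeWhile (\<lambda>j. j \<noteq> i) (g (controls m n x))). x j))"

text \<open>For \<open>x \<le> y\<close> the active controls of \<open>x\<close> are among those of
  \<open>y\<close>. If their numbers agree, the sets and thus the permutations agree, and a
  conjunction of components is monotone. Otherwise either \<open>x\<close> has fewer than
  \<open>k\<close> and its data go to zero, or \<open>y\<close> has more than \<open>k\<close> and
  its data go to one.\<close>

lemma path_network_monotone: "monotone_network n (path_network m n k g)"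
  unfolding monotone_network_def
proof
  show "network n (path_network m n k g)"
    by (auto simp: network_def cube_def path_network_def)
  show "mono_on (cube n) (path_network m n k g)"
  proof (rule mono_onI, rule le_funI)
    fix x y :: "nat \<Rightarrow> bool" and i
    assume le: "x \<le> y"
    let ?S = "controls m n x" and ?T = "controls m n y"
    have sub: "?S \<subseteq> ?T" and fin: "finite ?T"
      using le by (auto simp: controls_def le_fun_def)
    have card: "card ?S \<le> card ?T"
      using fin sub by (rule card_mono)
    have eq: "?S = ?T" if "card ?S = card ?T"
      using card_subset_eq[OF fin sub that] .
    show "path_network m n k g x i \<le> path_network m n k g y i"
    proof (cases "card ?S = card ?T")
      case True
      then show ?thesis
        using eq[OF True] le by (auto simp: path_network_def le_fun_def)
    next
      case False
      then show ?thesis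
        using card le by (auto simp: path_network_def le_fun_def)
    qed
  qed
qed

lemma controls_update:
  "i \<in> {1..n} \<Longrightarrow> controls m n (update (path_network m n k g) i x) = controls m n x"
  by (auto simp: controls_def update_def path_network_def)

lemma controls_update_word:
  "w \<in> lists {1..n} \<Longrightarrow> controls m n (update_word (path_network m n k g) w x) = controls m n x"
  by (induction w arbitrary: x) (simp_all add: controls_update)

text \<open>The on-components \<open>xs\<close> form a prefix of the path. Only an update of the
  first entry of \<open>ys\<close> changes the data: entries of \<open>xs\<close> have all
  predecessors on and stay on, while later entries of \<open>ys\<close> have that first entry as an
  off predecessor and stay off. Hence the letters of \<open>ys\<close> must be read in
  order.\<close>

lemma subseq_of_word_filling_path:
  assumes "w \<in> lists {1..n}" "card (controls m n x) = k" "g (controls m n x) = xs @ ys"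
    "distinct (xs @ ys)" "set (xs @ ys) = {1..m}" "m \<le> n"
    "\<forall>i\<in>set xs. x i" "\<forall>i\<in>set ys. \<not> x i"
    "\<forall>i\<in>{1..m}. update_word (path_network m n k g) w x i"
  shows "subseq ys w"
  using assms
proof (induction w arbitrary: x xs ys rule: list.induct)
  case Nil
  then have "ys = []"
    by (cases ys) auto
  then show ?case
    by simp
next
  case (Cons a w)
  let ?f = "path_network m n k g"
  let ?x = "update ?f a x"
  have a: "a \<in> {1..n}" and w: "w \<in> lists {1..n}"
    using Cons.prems(1) by simp_all
  have ctrl: "controls m n ?x = controls m n x"
    using a by (rule controls_update)
  show ?case
  proof (cases ys)
    case Nil
    then show ?thesis
      by simp
  next
    case ys: (Cons b zs)
    have upd: "?x a = (\<forall>j\<in>set (takeWhile (\<lambda>j. j \<noteq> a) (xs @ b # zs)). x j)" if "a \<le> m"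
      using that a Cons.prems(2,3) by (simp add: update_def path_network_def ys)
    have same: "?x j = x j" if "j \<noteq> a" for j
      using that by (simp add: update_def)
    have le_m: "j \<le> m" if "j \<in> set (xs @ ys)" for j
      using that Cons.prems(5) by auto
    show ?thesis
    proof (cases "a = b")
      case True
      have "takeWhile (\<lambda>j. j \<noteq> a) (xs @ b # zs) = xs"
        using True Cons.prems(4) by (auto simp: ys takeWhile_append intro: takeWhile_eq_all_conv[THEN iffD2])
      then have "?x a"
        using upd le_m True Cons.prems(7) by (simp add: ys)
      moreover have "\<forall>i\<in>set (xs @ zs). ?x i = x i"
      proof
        fix i assume "i \<in> set (xs @ zs)"
        then have "i \<noteq> a"
          using Cons.prems(4) True by (auto simp: ys)
        then show "?x i = x i"
          by (rule same)
      qed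
      \<comment> \<open>The updated component \<open>b\<close> moves from the off part to the on
        part of the path.\<close>
      ultimately have "subseq zs w"
        using Cons.prems(2-) w ctrl True
        by (intro Cons.IH[of ?x "xs @ [b]" zs]) (auto simp: ys)
      then show ?thesis
        using True by (simp add: ys)
    next
      case False
      have "?x a = x a" if "a \<in> set xs"
      proof -
        have "set (takeWhile (\<lambda>j. j \<noteq> a) (xs @ b # zs)) \<subseteq> set xs"
          using that by (auto simp: takeWhile_append dest: set_takeWhileD)
        then show ?thesis
          using upd le_m that Cons.prems(7) by auto
      qed
      moreover have "?x a = x a" if "a \<in> set ys"
      proof -
        have "a \<notin> set xs"
          using that Cons.prems(4) by auto
        then have "b \<in> set (takeWhile (\<lambda>j. j \<noteq> a) (xs @ b # zs))"
          using False by (auto simp: takeWhile_append)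
        then show ?thesis
          using upd le_m that Cons.prems(8) by (auto simp: ys)
      qed
      \<comment> \<open>This also covers a control letter \<open>a\<close>, which does not occur on
        the path; the split into \<open>xs\<close> and \<open>ys\<close> survives in every
        case.\<close>
      ultimately have "?x j = x j" if "j \<in> set (xs @ ys)" for j
        using same that by (cases "j = a") auto
      then have "subseq ys w"
        using Cons.prems w ctrl by (intro Cons.IH[of ?x xs ys]) auto
      then show ?thesis
        by auto
    qed
  qed
qed

text \<open>Along the permutation, each entry has all its predecessors on by induction, so the
  network sends it to one, and at a fixed point it must already be on.\<close>

lemma path_network_fixed_point_all_on:
  assumes fixed: "path_network m n k g x = x" and k: "card (controls m n x) = k"
    and perm: "g (controls m n x) \<in> permutations_of_set {1..m}" and "m \<le> n" "i \<in> {1..m}"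
  shows "x i"
proof -
  have prefix: "\<forall>j\<in>set xs. x j" if "g (controls m n x) = xs @ ys" for xs ys
    using that
  proof (induction xs arbitrary: ys rule: rev_induct)
    case Nil
    show ?case by simp
  next
    case (snoc a xs)
    have dist: "distinct (xs @ a # ys)" and set: "set (xs @ a # ys) = {1..m}"
      using perm snoc.prems by (auto simp: permutations_of_set_def)
    have IH: "\<forall>j\<in>set xs. x j"
      using snoc.IH[of "a # ys"] snoc.prems by simp
    have "a \<in> {1..m}"
      unfolding set[symmetric] by simp
    moreover have "takeWhile (\<lambda>j. j \<noteq> a) (xs @ a # ys) = xs"
      using dist by (auto simp: takeWhile_append intro: takeWhile_eq_all_conv[THEN iffD2])
    ultimately have "path_network m n k g x a"
      using k \<open>m \<le> n\<close> IH snoc.prems by (simp add: path_network_def)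
    then show ?case
      using fixed IH by simp
  qed
  show ?thesis
    using prefix[of "g (controls m n x)" "[]"] perm \<open>i \<in> {1..m}\<close>
    by (auto simp: permutations_of_set_def)
qed

lemma subseq_of_fixing_word:
  assumes fixing: "fixing_word n (path_network m n k g) w"
    and S: "S \<subseteq> {m<..n}" "card S = k" and perm: "g S \<in> permutations_of_set {1..m}"
    and "m \<le> n"
  shows "subseq (g S) (filter (\<lambda>i. i \<in> {1..m}) w)"
proof -
  let ?f = "path_network m n k g"
  \<comment> \<open>Exactly the controls in \<open>S\<close> are on and all data are off, so the
    fixing word has to fill the whole path \<open>g S\<close>.\<close>
  define x where "x = (\<lambda>i\<in>{1..n}. i \<in> S)"
  have x: "x \<in> cube n"
    by (auto simp: x_def cube_def)
  have ctrl: "controls m n x = S"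
    using S(1) by (auto simp: controls_def x_def)
  have w: "w \<in> lists {1..n}" and fixed: "?f (update_word ?f w x) = update_word ?f w x"
    using fixing x by (auto simp: fixing_word_def)
  have set: "set (g S) = {1..m}" and dist: "distinct (g S)"
    using perm by (auto simp: permutations_of_set_def)
  have "\<forall>i\<in>{1..m}. update_word ?f w x i"
    using path_network_fixed_point_all_on[OF fixed] controls_update_word[OF w] ctrl S(2) perm
      \<open>m \<le> n\<close> by simp
  moreover have "\<forall>i\<in>set (g S). \<not> x i"
    using set S(1) \<open>m \<le> n\<close> by (auto simp: x_def)
  ultimately have "subseq (g S) w"
    using w ctrl S(2) set dist \<open>m \<le> n\<close>
    by (intro subseq_of_word_filling_path[where xs = "[]" and x = x]) auto
  \<comment> \<open>Control letters are dropped, since the counting argument concerns words over the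
    data letters only.\<close>
  then have "subseq (filter (\<lambda>i. i \<in> {1..m}) (g S)) (filter (\<lambda>i. i \<in> {1..m}) w)"
    by (rule subseq_filter)
  moreover have "filter (\<lambda>i. i \<in> {1..m}) (g S) = g S"
    using set by (simp add: filter_id_conv)
  ultimately show ?thesis
    by simp
qed

section \<open>Choice of parameters and the quadratic bound\<close>

text \<open>The left side is at most \<open>m ^ 3 / 18\<close>, the right side at least
  \<open>(m / 4) ^ 4 = m ^ 4 / 256\<close>. The latter is larger as soon as
  \<open>18 * m > 256\<close>, which \<open>m \<ge> 15\<close> ensures; hence the threshold 30 for
  \<open>n\<close>.\<close>

lemma many_four_subsets:
  assumes "n \<ge> 30" "m = n div 2" "L = m\<^sup>2 div 18"
  shows "m * L < (n - m) choose 4"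
proof -
  have m: "m \<ge> 15" "m \<le> n - m"
    using assms by auto
  have "real L \<le> (real m)\<^sup>2 / 18"
    using of_nat_div_le_of_nat[of "m\<^sup>2" 18, where 'a = real] assms(3) by simp
  then have "real m * real L \<le> real m * ((real m)\<^sup>2 / 18)"
    by (rule mult_left_mono) simp
  also have "\<dots> = real m ^ 3 / 18"
    by (simp add: eval_nat_numeral)
  also have "\<dots> < real m ^ 3 * real m / 256"
    using m by simp
  also have "\<dots> = (real m / 4) ^ 4"
    by (simp add: eval_nat_numeral)
  also have "\<dots> \<le> (real (n - m) / real 4) ^ 4"
    using m by (intro power_mono) auto
  also have "\<dots> \<le> real ((n - m) choose 4)"
    using m binomial_ge_n_over_k_pow_k[of 4 "n - m", where 'a = real] by simp
  finally show ?thesis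
    by (simp flip: of_nat_mult)
qed

lemma quadratic_fixing_length:
  assumes "n \<ge> 30"
  shows "\<exists>f. monotone_network n f \<and> (real n)\<^sup>2 / 900 \<le> real (fixing_length n f)"
proof -
  define m where "m = n div 2"
  define L where "L = m\<^sup>2 div 18"
  define I where "I = {S. S \<subseteq> {m<..n} \<and> card S = 4}"
  have m: "m \<ge> 1" "m \<le> n" "n \<le> 3 * m"
    using assms by (auto simp: m_def)
  have "card I > m * L"
    unfolding I_def using many_four_subsets[OF assms m_def L_def] by (simp add: n_subsets)
  moreover have "finite I"
    unfolding I_def by simp
  ultimately obtain g where g: "\<And>S. S \<in> I \<Longrightarrow> g S \<in> permutations_of_set {1..m}"
    "\<And>w. w \<in> lists {1..m} \<Longrightarrow> (\<And>S. S \<in> I \<Longrightarrow> subseq (g S) w) \<Longrightarrow> length w > L"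
    using permutations_without_short_supersequence[of "{1..m}" I L] m(1)
    by (auto simp: L_def)
  let ?f = "path_network m n 4 g"
  have mono: "monotone_network n ?f"
    by (rule path_network_monotone)
  \<comment> \<open>The successor absorbs the rounding in
    \<open>L = m\<^sup>2 div 18\<close>.\<close>
  have "Suc L \<le> fixing_length n ?f"
  proof (rule fixing_length_geI[OF monotone_network_fixable[OF mono]])
    fix w assume w: "fixing_word n ?f w"
    have "length (filter (\<lambda>i. i \<in> {1..m}) w) > L"
      using subseq_of_fixing_word[OF w] g(1) m(2) by (intro g(2)) (auto simp: I_def)
    then show "Suc L \<le> length w"
      using length_filter_le[of "\<lambda>i. i \<in> {1..m}" w] by linarith
  qed
  moreover have "m\<^sup>2 \<le> 18 * Suc L"
    unfolding L_def by simp
  moreover have "n\<^sup>2 \<le> (3 * m)\<^sup>2"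
    using m(3) by (rule power_mono) simp
  \<comment> \<open>The estimates give the factor 9 * 18 = 162. The weaker 900 = 30 * 30 makes the
    claimed bound at most 1 when \<open>n < 30\<close>.\<close>
  ultimately have "n\<^sup>2 \<le> 900 * fixing_length n ?f"
    by (simp add: power_mult_distrib)
  then have "(real n)\<^sup>2 \<le> 900 * real (fixing_length n ?f)"
    by (metis of_nat_le_iff of_nat_mult of_nat_numeral of_nat_power)
  then show ?thesis
    using mono by (intro exI[of _ ?f]) simp
qed

text \<open>This serves the values of \<open>n\<close> below 30. The constant all-one network is not
  fixed by the empty word, because the all-zero configuration is not a fixed point.\<close>

lemma positive_fixing_length:
  assumes "n \<ge> 1"
  shows "\<exists>f. monotone_network n f \<and> 1 \<le> fixing_length n f"
proof -
  define f :: "(nat \<Rightarrow> bool) \<Rightarrow> nat \<Rightarrow> bool" where "f x = (\<lambda>i\<in>{1..n}. True)" for x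
  have mono: "monotone_network n f"
    by (auto simp: monotone_network_def network_def cube_def f_def intro: mono_onI)
  have "1 \<le> length w" if "fixing_word n f w" for w
  proof (rule ccontr)
    assume "\<not> 1 \<le> length w"
    then have "w = []"
      by (cases w) auto
    moreover have "(\<lambda>i\<in>{1..n}. False) \<in> cube n"
      by (auto simp: cube_def)
    ultimately have "f (\<lambda>i\<in>{1..n}. False) = (\<lambda>i\<in>{1..n}. False)"
      using that by (auto simp: fixing_word_def)
    from fun_cong[OF this, of 1] show False
      using assms by (simp add: f_def)
  qed
  then show ?thesis
    using mono fixing_length_geI[OF monotone_network_fixable[OF mono]] by blast
qed

theorem theorem2:
  shows "\<exists>c::real. c > 0 \<and>
    (\<forall>n::nat. n \<ge> 1 \<longrightarrow>
      (\<exists>f. monotone_network n f \<and> fixable n f \<and> real (fixing_length n f) \<ge> c * (real n)\<^sup>2))"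
proof (intro exI[of _ "1 / 900"] conjI allI impI)
  fix n :: nat
  assume n: "n \<ge> 1"
  have "\<exists>f. monotone_network n f \<and> (real n)\<^sup>2 / 900 \<le> real (fixing_length n f)"
  proof (cases "n \<ge> 30")
    case True
    then show ?thesis
      by (rule quadratic_fixing_length)
  next
    case False
    then have "(real n)\<^sup>2 \<le> 30\<^sup>2"
      by (intro power_mono) auto
    then have small: "(real n)\<^sup>2 / 900 \<le> 1"
      by simp
    obtain f where f: "monotone_network n f" "1 \<le> fixing_length n f"
      using positive_fixing_length[OF n] by blast
    have "1 \<le> real (fixing_length n f)"
      using f(2) by simp
    then show ?thesis
      using f(1) small order_trans by blast
  qed
  then show "\<exists>f. monotone_network n f \<and> fixable n f \<and>
      1 / 900 * (real n)\<^sup>2 \<le> real (fixing_length n f)"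
    using monotone_network_fixable by auto
qed simp

end
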